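(* Let $X$ be a separable complex Fréchet space and let $T\in\mathfrak L(X)$. If the $\mathbb T$-eigenvectors of $T$ are perfectly spanning, then $T$ is hereditarily $\mathcal U$-frequently hypercyclic.
   Context: The $\mathbb T$-eigenvectors of $T$ are perfectly spanning if for every countable set $N\subset\mathbb T$, the eigenvectors of $T$ with eigenvalues in $\mathbb T\setminus N$ span a dense linear subspace of $X$. The upper density of $A\subset\mathbb N$ is $\limsup_N\#(A\cap[1,N])/N$. $\mathcal N_T(x,V):=\{n\in\mathbb N:T^nx\in V\}$. $T$ is hereditarily $\mathcal U$-frequently hypercyclic if for every countable family $(V_i)_{i\in I}$ of non-empty open subsets of $X$ and every family $(A_i)_{i\in I}$ of subsets of $\mathbb N$ with positive upper density, there exists $x\in X$ such that $\mathcal N_T(x,V_i)\cap A_i$ has positive upper density for every $i\in I$. *)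

theory Defs
  imports "HOL-Analysis.Analysis"
begin

definition locally_convex :: "(complex \<Rightarrow> 'a::{ab_group_add,topological_space} \<Rightarrow> 'a) \<Rightarrow> bool" where
  "locally_convex sc \<longleftrightarrow>
     (\<forall>U. open U \<and> 0 \<in> U \<longrightarrow>
        (\<exists>V. open V \<and> 0 \<in> V \<and> V \<subseteq> U \<and>
            (\<forall>x\<in>V. \<forall>y\<in>V. \<forall>t::real. 0 \<le> t \<and> t \<le> 1 \<longrightarrow>
               sc (complex_of_real t) x + sc (complex_of_real (1 - t)) y \<in> V)))"

definition frechet_space :: "(complex \<Rightarrow> 'a::{ab_group_add,metric_space} \<Rightarrow> 'a) \<Rightarrow> bool" where
  "frechet_space sc \<longleftrightarrow>
     vector_space sc \<and>
     (\<forall>x y z::'a. dist (x + z) (y + z) = dist x y) \<and>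
     complete (UNIV :: 'a set) \<and>
     continuous_on UNIV (\<lambda>p::'a \<times> 'a. fst p + snd p) \<and>
     continuous_on UNIV (\<lambda>p::complex \<times> 'a. sc (fst p) (snd p)) \<and>
     locally_convex sc"

definition bounded_operator :: "(complex \<Rightarrow> 'a::{ab_group_add,topological_space} \<Rightarrow> 'a) \<Rightarrow> ('a \<Rightarrow> 'a) \<Rightarrow> bool" where
  "bounded_operator sc T \<longleftrightarrow> Vector_Spaces.linear sc sc T \<and> continuous_on UNIV T"

definition unimodular_eigenvectors ::
  "(complex \<Rightarrow> 'a::ab_group_add \<Rightarrow> 'a) \<Rightarrow> ('a \<Rightarrow> 'a) \<Rightarrow> complex set \<Rightarrow> 'a set" where
  "unimodular_eigenvectors sc T N =
     {x. x \<noteq> 0 \<and> (\<exists>c. cmod c = 1 \<and> c \<notin> N \<and> T x = sc c x)}"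

definition perfectly_spanning_T_eigenvectors ::
  "(complex \<Rightarrow> 'a::{ab_group_add,topological_space} \<Rightarrow> 'a) \<Rightarrow> ('a \<Rightarrow> 'a) \<Rightarrow> bool" where
  "perfectly_spanning_T_eigenvectors sc T \<longleftrightarrow>
     (\<forall>N. countable N \<and> N \<subseteq> {z. cmod z = 1} \<longrightarrow>
        closure (module.span sc (unimodular_eigenvectors sc T N)) = UNIV)"

definition upper_density :: "nat set \<Rightarrow> ereal" where
  "upper_density A = limsup (\<lambda>N. ereal (real (card (A \<inter> {1..N})) / real N))"

definition return_set :: "('a \<Rightarrow> 'a) \<Rightarrow> 'a \<Rightarrow> 'a set \<Rightarrow> nat set" where
  "return_set T x V = {n. (T ^^ n) x \<in> V}"

text \<open>Countable families are indexed by subsets of nat.\<close>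
definition hereditarily_U_frequently_hypercyclic :: "('a::topological_space \<Rightarrow> 'a) \<Rightarrow> bool" where
  "hereditarily_U_frequently_hypercyclic T \<longleftrightarrow>
     (\<forall>(I::nat set) (V::nat \<Rightarrow> 'a set) (A::nat \<Rightarrow> nat set).
        (\<forall>i\<in>I. open (V i) \<and> V i \<noteq> {} \<and> upper_density (A i) > 0) \<longrightarrow>
        (\<exists>x. \<forall>i\<in>I. upper_density (return_set T x (V i) \<inter> A i) > 0))"

end

theory Submission
  imports Defs
begin

text \<open>
  Given \<open>V\<close> open and a set \<open>A\<close> of positive upper density, write a point of
  \<open>V\<close> as (approximately) a sum of unimodular eigenvectors. The rotations induced on the
  finitely many eigenvectors live on a torus, so by the pigeonhole principle they are almost
  constant along some \<open>B \<subseteq> A\<close> of positive upper density; undoing that constant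
  rotation gives a vector \<open>v\<close> whose orbit is in \<open>V\<close> along \<open>B\<close>.

  Perfect spanning and separability allow one to use only eigenvectors \<open>h\<close> that are limits of
  eigenvectors with infinitely many different eigenvalues. Averaging \<open>M\<close> such neighbours of
  \<open>h\<close> gives \<open>u\<close> close to \<open>h\<close> whose orbit is near 0 outside a set of density
  \<open>O(1/M)\<close>, by orthogonality of characters. Hence such \<open>u\<close> are dense, and so are the vectors
  \<open>u + v\<close>, which still visit \<open>V\<close> along most of \<open>B\<close>, with a density bound
  depending only on \<open>V\<close> and \<open>A\<close>. The Baire category theorem then handles countably
  many pairs simultaneously.
\<close>

section \<open>Upper density\<close>

text \<open>Counting inequalities, unlike a limsup, can be combined at a common \<open>n\<close>:
  one that holds frequently meets one that holds eventually. Density is used in this form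
  throughout.\<close>

lemma upper_density_pos_iff:
  "upper_density A > 0 \<longleftrightarrow>
    (\<exists>\<beta>>0. \<exists>\<^sub>F n in sequentially. real (card (A \<inter> {1..n})) > \<beta> * real n)"
proof
  assume pos: "upper_density A > 0"
  then obtain \<beta> where \<beta>: "0 < \<beta>" "ereal \<beta> < upper_density A"
    using ereal_dense2[OF pos] by auto
  have "\<exists>\<^sub>F n in sequentially. real (card (A \<inter> {1..n})) > \<beta> * real n"
  proof (rule ccontr)
    assume "\<not> ?thesis"
    then have "\<forall>\<^sub>F n in sequentially. real (card (A \<inter> {1..n})) \<le> \<beta> * real n"
      by (simp add: not_frequently not_less)
    then have "\<forall>\<^sub>F n in sequentially. ereal (real (card (A \<inter> {1..n})) / real n) \<le> ereal \<beta>"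
      using eventually_gt_at_top[of 0] by eventually_elim (simp add: divide_le_eq)
    then have "upper_density A \<le> ereal \<beta>"
      unfolding upper_density_def by (rule Limsup_bounded)
    with \<beta> show False by simp
  qed
  with \<beta> show "\<exists>\<beta>>0. \<exists>\<^sub>F n in sequentially. real (card (A \<inter> {1..n})) > \<beta> * real n"
    by blast
next
  assume "\<exists>\<beta>>0. \<exists>\<^sub>F n in sequentially. real (card (A \<inter> {1..n})) > \<beta> * real n"
  then obtain \<beta> where \<beta>: "\<beta> > 0"
    and freq: "\<exists>\<^sub>F n in sequentially. real (card (A \<inter> {1..n})) > \<beta> * real n" by blast
  show "upper_density A > 0"
  proof (rule ccontr)
    assume "\<not> ?thesis"
    then have "upper_density A < ereal \<beta>"
      using \<beta> by (meson ereal_less(2) le_less_trans not_less)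
    then have "\<forall>\<^sub>F n in sequentially. ereal (real (card (A \<inter> {1..n})) / real n) < ereal \<beta>"
      unfolding upper_density_def by (rule Limsup_lessD)
    then have "\<forall>\<^sub>F n in sequentially. \<not> real (card (A \<inter> {1..n})) > \<beta> * real n"
      using eventually_gt_at_top[of 0] by eventually_elim (simp add: divide_less_eq)
    with freq show False
      by (simp add: frequently_def)
  qed
qed

text \<open>Pigeonhole by subadditivity: if no piece had positive upper density, each would
  eventually contribute at most \<open>\<gamma> * n\<close>, and finitely many such contributions
  stay below \<open>\<beta> * n\<close>.\<close>

lemma upper_density_pos_cover:
  assumes fin: "finite C" and cover: "A \<subseteq> (\<Union>c\<in>C. B c)" and pos: "upper_density A > 0"
  shows "\<exists>c\<in>C. upper_density (A \<inter> B c) > 0"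
proof (rule ccontr)
  assume none: "\<not> ?thesis"
  obtain \<beta> where \<beta>: "\<beta> > 0"
    and freq: "\<exists>\<^sub>F n in sequentially. real (card (A \<inter> {1..n})) > \<beta> * real n"
    using pos unfolding upper_density_pos_iff by blast
  \<comment> \<open>The added 1 keeps \<open>\<gamma>\<close> positive even for empty
    \<open>C\<close>.\<close>
  define \<gamma> where "\<gamma> = \<beta> / real (card C + 1)"
  have \<gamma>: "\<gamma> > 0" "real (card C) * \<gamma> \<le> \<beta>"
    using \<beta> by (simp_all add: \<gamma>_def field_simps)
  have "\<forall>c\<in>C. \<forall>\<^sub>F n in sequentially. real (card (A \<inter> B c \<inter> {1..n})) \<le> \<gamma> * real n"
  proof
    fix c assume "c \<in> C"
    then have "\<not> (\<exists>\<^sub>F n in sequentially. real (card (A \<inter> B c \<inter> {1..n})) > \<gamma> * real n)"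
      using none \<gamma>(1) unfolding upper_density_pos_iff by blast
    then show "\<forall>\<^sub>F n in sequentially. real (card (A \<inter> B c \<inter> {1..n})) \<le> \<gamma> * real n"
      by (simp add: not_frequently not_less)
  qed
  then have "\<forall>\<^sub>F n in sequentially. \<forall>c\<in>C. real (card (A \<inter> B c \<inter> {1..n})) \<le> \<gamma> * real n"
    by (rule eventually_ball_finite[OF fin])
  then have "\<forall>\<^sub>F n in sequentially. \<not> real (card (A \<inter> {1..n})) > \<beta> * real n"
  proof eventually_elim
    case (elim n)
    have "A \<inter> {1..n} \<subseteq> (\<Union>c\<in>C. A \<inter> B c \<inter> {1..n})"
      using cover by blast
    then have "card (A \<inter> {1..n}) \<le> card (\<Union>c\<in>C. A \<inter> B c \<inter> {1..n})"
      by (rule card_mono[rotated]) (use fin in auto)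
    also have "\<dots> \<le> (\<Sum>c\<in>C. card (A \<inter> B c \<inter> {1..n}))"
      by (rule card_UN_le[OF fin])
    finally have "real (card (A \<inter> {1..n})) \<le> (\<Sum>c\<in>C. real (card (A \<inter> B c \<inter> {1..n})))"
      by (metis of_nat_le_iff of_nat_sum)
    also have "\<dots> \<le> real (card C) * (\<gamma> * real n)"
      using elim by (intro sum_bounded_above) blast
    also have "\<dots> \<le> \<beta> * real n"
      using mult_right_mono[OF \<gamma>(2), of "real n"] by (simp add: mult.assoc)
    finally show ?case by simp
  qed
  with freq show False by (simp add: frequently_def)
qed

section \<open>Orthogonality of characters on the circle\<close>

text \<open>For \<open>w \<noteq> 1\<close> the geometric sum telescopes and stays bounded by
  \<open>2 / cmod (1 - w)\<close>, so dividing by \<open>n\<close> kills it.\<close>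

lemma unimodular_power_average:
  fixes w :: complex
  assumes "cmod w = 1"
  shows "(\<lambda>n. (\<Sum>k=1..n. w ^ k) / of_nat n) \<longlonglongrightarrow> (if w = 1 then 1 else 0)"
proof (cases "w = 1")
  case True
  have "(\<lambda>n. (\<Sum>k=1..n. w ^ k) / of_nat n) \<longlonglongrightarrow> 1"
    by (rule tendsto_eventually) (use True in \<open>auto intro!: eventually_mono[OF eventually_gt_at_top[of 0]]\<close>)
  with True show ?thesis by simp
next
  case False
  have "(\<lambda>n. (\<Sum>k=1..n. w ^ k) / of_nat n) \<longlonglongrightarrow> 0"
  proof (rule Lim_null_comparison)
    show "\<forall>\<^sub>F n in sequentially. norm ((\<Sum>k=1..n. w ^ k) / of_nat n) \<le> (2 / cmod (1 - w)) / real n"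
    proof (rule eventuallyI)
      fix n
      have "(1 - w) * (\<Sum>k=1..n. w ^ k) = w - w ^ Suc n"
      proof (induction n)
        case (Suc n)
        have "(1 - w) * (\<Sum>k=1..Suc n. w ^ k) = (1 - w) * (\<Sum>k=1..n. w ^ k) + (1 - w) * w ^ Suc n"
          by (simp add: distrib_left)
        also have "\<dots> = w - w ^ Suc (Suc n)"
          unfolding Suc.IH by (simp add: algebra_simps)
        finally show ?case .
      qed simp
      then have "cmod (1 - w) * cmod (\<Sum>k=1..n. w ^ k) \<le> cmod w + cmod (w ^ Suc n)"
        by (metis norm_mult norm_triangle_ineq4)
      then have "cmod (1 - w) * cmod (\<Sum>k=1..n. w ^ k) \<le> 2"
        using assms by (simp add: norm_mult norm_power)
      then have "cmod (\<Sum>k=1..n. w ^ k) \<le> 2 / cmod (1 - w)"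
        using False by (simp add: field_simps)
      then show "norm ((\<Sum>k=1..n. w ^ k) / of_nat n) \<le> (2 / cmod (1 - w)) / real n"
        unfolding norm_divide norm_of_nat by (rule divide_right_mono) simp
    qed
    show "(\<lambda>n. (2 / cmod (1 - w)) / real n) \<longlonglongrightarrow> 0"
      by (rule lim_const_over_n)
  qed
  with False show ?thesis by simp
qed

text \<open>Expanding the square gives averages of powers of \<open>a * cnj b\<close>. On the circle
  conjugation is inversion, so only the \<open>card L\<close> diagonal pairs survive in the
  limit.\<close>

lemma mean_square_power_sums:
  assumes "finite L" and unit: "\<And>z. z \<in> L \<Longrightarrow> cmod z = 1"
  shows "(\<lambda>n. (\<Sum>k=1..n. (cmod (\<Sum>z\<in>L. z ^ k))\<^sup>2) / real n) \<longlonglongrightarrow> real (card L)"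
proof -
  have expand: "complex_of_real ((\<Sum>k=1..n. (cmod (\<Sum>z\<in>L. z ^ k))\<^sup>2) / real n)
      = (\<Sum>a\<in>L. \<Sum>b\<in>L. (\<Sum>k=1..n. (a * cnj b) ^ k) / of_nat n)" for n
  proof -
    have "complex_of_real ((cmod (\<Sum>z\<in>L. z ^ k))\<^sup>2) = (\<Sum>a\<in>L. \<Sum>b\<in>L. (a * cnj b) ^ k)" for k
      unfolding complex_norm_square by (simp add: sum_product power_mult_distrib)
    then have "complex_of_real (\<Sum>k=1..n. (cmod (\<Sum>z\<in>L. z ^ k))\<^sup>2)
        = (\<Sum>k=1..n. \<Sum>a\<in>L. \<Sum>b\<in>L. (a * cnj b) ^ k)"
      by simp
    also have "\<dots> = (\<Sum>a\<in>L. \<Sum>k=1..n. \<Sum>b\<in>L. (a * cnj b) ^ k)"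
      by (rule sum.swap)
    also have "\<dots> = (\<Sum>a\<in>L. \<Sum>b\<in>L. \<Sum>k=1..n. (a * cnj b) ^ k)"
      by (intro sum.cong refl sum.swap)
    finally show ?thesis
      by (simp only: of_real_divide of_real_of_nat_eq sum_divide_distrib[symmetric])
  qed
  have diag: "a * cnj b = 1 \<longleftrightarrow> a = b" if "a \<in> L" "b \<in> L" for a b
  proof -
    have "b * cnj b = 1"
      using unit[OF that(2)] by (simp add: complex_norm_square[symmetric])
    then show ?thesis
      by (metis mult.commute mult.left_commute mult.right_neutral)
  qed
  have "(\<lambda>n. \<Sum>a\<in>L. \<Sum>b\<in>L. (\<Sum>k=1..n. (a * cnj b) ^ k) / of_nat n)
      \<longlonglongrightarrow> (\<Sum>a\<in>L. \<Sum>b\<in>L. if a * cnj b = 1 then 1 else 0)"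
    by (intro tendsto_sum unimodular_power_average) (simp add: norm_mult unit)
  also have "(\<Sum>a\<in>L. \<Sum>b\<in>L. if a * cnj b = 1 then 1 else 0) = (\<Sum>a\<in>L. \<Sum>b\<in>L. if a = b then 1 else (0::complex))"
    by (intro sum.cong refl) (simp add: diag)
  also have "\<dots> = complex_of_real (real (card L))"
    using assms(1) by simp
  finally show ?thesis
    unfolding expand[symmetric] tendsto_of_real_iff .
qed

text \<open>Chebyshev's inequality: the mean square of the normalized sum tends to
  \<open>1 / card L\<close>, so values of modulus at least \<delta> occupy upper density at most
  \<open>1 / (card L * \<delta>\<^sup>2)\<close>, which is below \<eta>.\<close>

lemma power_average_rarely_large:
  assumes fin: "finite L" and unit: "\<And>z. z \<in> L \<Longrightarrow> cmod z = 1"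
    and pos: "\<delta> > 0" "\<eta> > 0" and large: "real (card L) * \<delta>\<^sup>2 * \<eta> > 1"
  shows "\<forall>\<^sub>F n in sequentially.
    real (card {k\<in>{1..n}. cmod (\<Sum>z\<in>L. z ^ k / of_nat (card L)) \<ge> \<delta>}) \<le> \<eta> * real n"
proof -
  define M where "M = real (card L)"
  have M: "M > 0" using large pos by (auto simp: M_def intro!: Nat.gr0I)
  \<comment> \<open>The limit \<open>M\<close> of the unnormalized mean squares lies strictly below
    the Chebyshev threshold, so eventually the mean squares do too.\<close>
  have "M < (M * \<delta>)\<^sup>2 * \<eta>"
    using mult_strict_left_mono[OF large[folded M_def] M] by (simp add: power2_eq_square algebra_simps)
  then have "\<forall>\<^sub>F n in sequentially. (\<Sum>k=1..n. (cmod (\<Sum>z\<in>L. z ^ k))\<^sup>2) / real n < (M * \<delta>)\<^sup>2 * \<eta>"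
    using order_tendstoD(2)[OF mean_square_power_sums[OF fin unit]] by (simp add: M_def)
  then show ?thesis
    using eventually_gt_at_top[of 0]
  proof eventually_elim
    case (elim n)
    define K where "K = {k\<in>{1..n}. cmod (\<Sum>z\<in>L. z ^ k / of_nat (card L)) \<ge> \<delta>}"
    have "(M * \<delta>)\<^sup>2 \<le> (cmod (\<Sum>z\<in>L. z ^ k))\<^sup>2" if "k \<in> K" for k
    proof (rule power_mono)
      have "\<delta> \<le> cmod (\<Sum>z\<in>L. z ^ k) / M"
        using that by (simp add: K_def M_def sum_divide_distrib[symmetric] norm_divide)
      then show "M * \<delta> \<le> cmod (\<Sum>z\<in>L. z ^ k)"
        using M by (simp add: field_simps)
    qed (use M pos in simp)
    then have "real (card K) * (M * \<delta>)\<^sup>2 \<le> (\<Sum>k\<in>K. (cmod (\<Sum>z\<in>L. z ^ k))\<^sup>2)"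
      by (rule sum_bounded_below)
    also have "\<dots> \<le> (\<Sum>k=1..n. (cmod (\<Sum>z\<in>L. z ^ k))\<^sup>2)"
      by (rule sum_mono2) (auto simp: K_def)
    also have "\<dots> \<le> (M * \<delta>)\<^sup>2 * \<eta> * real n"
      using elim by (simp add: divide_less_eq)
    finally have "(M * \<delta>)\<^sup>2 * real (card K) \<le> (M * \<delta>)\<^sup>2 * (\<eta> * real n)"
      by (simp add: algebra_simps)
    then show ?case
      using M pos by (simp add: K_def)
  qed
qed

section \<open>Estimates for a translation-invariant metric, and iterates of
  \<open>T\<close>\<close>

locale frechet_operator = Vector_Spaces.linear sc sc T
  for sc :: "complex \<Rightarrow> 'a::{ab_group_add,metric_space} \<Rightarrow> 'a" and T :: "'a \<Rightarrow> 'a" +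
  assumes dist_translate: "dist (x + z) (y + z) = dist x (y::'a)"
    and complete_space: "complete (UNIV :: 'a set)"
    and continuous_scale: "continuous_on UNIV (\<lambda>p::complex \<times> 'a. sc (fst p) (snd p))"
    and continuous_T: "continuous_on UNIV T"
begin

lemma dist_diff_0: "dist x y = dist (x - y) (0::'a)"
  using dist_translate[of "x - y" y 0] by simp

lemma dist_add_le: "dist (a + b) (c + d) \<le> dist a c + dist b (d::'a)"
proof -
  have "dist (a + b) (c + d) \<le> dist (a + b) (c + b) + dist (b + c) (d + c)"
    using dist_triangle[of "a + b" "c + d" "c + b"] by (simp add: add.commute)
  then show ?thesis by (simp only: dist_translate)
qed

lemma dist_sum_0_le: "dist (\<Sum>i\<in>L. f i) (0::'a) \<le> (\<Sum>i\<in>L. dist (f i) 0)"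
proof (induction L rule: infinite_finite_induct)
  case (insert i L)
  then show ?case
    using dist_add_le[of "f i" "\<Sum>i\<in>L. f i" 0 0] by simp
qed simp_all

lemma continuous_scale_pair:
  "0 < e \<Longrightarrow> \<exists>\<delta>>0. \<forall>c x. dist c c\<^sub>0 < \<delta> \<longrightarrow> dist x x\<^sub>0 < \<delta> \<longrightarrow> dist (sc c x) (sc c\<^sub>0 x\<^sub>0) < e"
proof -
  assume "0 < e"
  then obtain \<delta> where \<delta>: "\<delta> > 0"
    "\<And>c x. dist (c, x) (c\<^sub>0, x\<^sub>0) < \<delta> \<Longrightarrow> dist (sc c x) (sc c\<^sub>0 x\<^sub>0) < e"
    using continuous_scale unfolding continuous_on_iff by fastforce
  have "dist (c, x) (c\<^sub>0, x\<^sub>0) < \<delta>" if "dist c c\<^sub>0 < \<delta> / 2" "dist x x\<^sub>0 < \<delta> / 2" for c x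
    using that sqrt_sum_squares_le_sum[of "dist c c\<^sub>0" "dist x x\<^sub>0"] by (simp add: dist_Pair_Pair)
  with \<delta> show ?thesis
    by (intro exI[of _ "\<delta> / 2"]) auto
qed

lemma small_scalar: "0 < e \<Longrightarrow> \<exists>\<delta>>0. \<forall>c. cmod c < \<delta> \<longrightarrow> dist (sc c x) 0 < e"
  using continuous_scale_pair[of e 0 x] by auto

text \<open>Translation invariance turns continuity of \<open>sc c\<close> at 0 into uniform
  continuity.\<close>

lemma scale_close: "0 < e \<Longrightarrow> \<exists>\<delta>>0. \<forall>x y. dist x y < \<delta> \<longrightarrow> dist (sc c x) (sc c y) < e"
proof -
  assume "0 < e"
  from continuous_scale_pair[OF this, of c 0] obtain \<delta>
    where \<delta>: "\<delta> > 0" "\<And>x. dist x 0 < \<delta> \<Longrightarrow> dist (sc c x) 0 < e" by auto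
  have "dist (sc c x) (sc c y) < e" if "dist x y < \<delta>" for x y
    using \<delta>(2)[of "x - y"] that
    by (simp add: dist_diff_0[of x y] dist_diff_0[of "sc c x" "sc c y"] vs1.scale_right_diff_distrib)
  with \<delta>(1) show ?thesis by blast
qed

text \<open>The metric need not be homogeneous, so a scalar of modulus at most 1 may increase the
  distance to 0. This supplies a bound uniform in such scalars.\<close>

lemma small_balanced:
  assumes "0 < e"
  shows "\<exists>\<delta>>0. \<forall>c x. cmod c \<le> 1 \<longrightarrow> dist x 0 < \<delta> \<longrightarrow> dist (sc c x) 0 < e"
proof -
  obtain r where r: "r > 0" "\<And>c x. cmod c < r \<Longrightarrow> dist x 0 < r \<Longrightarrow> dist (sc c x) 0 < e"
    using continuous_scale_pair[OF assms, of 0 0] by auto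
  \<comment> \<open>Moving the factor \<open>r / 2\<close> into the scalar and \<open>2 / r\<close>
    into the vector leaves \<open>sc c x\<close> unchanged and brings both entries below
    \<open>r\<close>.\<close>
  obtain \<delta> where \<delta>: "\<delta> > 0" "\<And>x. dist x 0 < \<delta> \<Longrightarrow> dist (sc (of_real (2 / r)) x) 0 < r"
    using scale_close[OF r(1), of "of_real (2 / r)"] by (metis vs1.scale_zero_right)
  have "dist (sc c x) 0 < e" if "cmod c \<le> 1" "dist x 0 < \<delta>" for c x
  proof -
    have "cmod (c * of_real (r / 2)) \<le> 1 * (r / 2)"
      unfolding norm_mult using that(1) r(1) by (intro mult_mono) auto
    then have "cmod (c * of_real (r / 2)) < r"
      using r(1) by linarith
    moreover have "sc (c * of_real (r / 2)) (sc (of_real (2 / r)) x) = sc c x"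
      using r(1) by (simp add: vs1.scale_scale mult.assoc of_real_mult[symmetric] del: of_real_mult)
    ultimately show ?thesis
      using r(2) \<delta>(2)[OF that(2)] by metis
  qed
  with \<delta>(1) show ?thesis by blast
qed

lemma funpow_add: "(T ^^ k) (x + y) = (T ^^ k) x + (T ^^ k) y"
  by (induction k) (simp_all add: add)

lemma funpow_scale: "(T ^^ k) (sc c x) = sc c ((T ^^ k) x)"
  by (induction k) (simp_all add: scale)

lemma funpow_sum: "(T ^^ k) (\<Sum>i\<in>L. f i) = (\<Sum>i\<in>L. (T ^^ k) (f i))"
  by (induction k) (simp_all add: sum)

lemma funpow_eigenvector: "T x = sc c x \<Longrightarrow> (T ^^ k) x = sc (c ^ k) x"
  by (induction k) (simp_all add: scale vs1.scale_scale mult.commute)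

lemma continuous_funpow: "continuous_on UNIV (T ^^ k)"
proof (induction k)
  case (Suc k)
  then show ?case
    using continuous_on_compose2[OF continuous_T Suc] by (simp add: comp_def)
qed (simp add: continuous_on_id[unfolded id_def] id_def)

text \<open>Used for both \<open>steerable\<close> and \<open>vanishable\<close>: it remains to
  check each property on eigenvectors, under linear combinations and under limits.\<close>

lemma closed_subspace_UNIV:
  assumes dense: "closure (vs1.span E) = UNIV"
    and E: "E \<subseteq> S" and sub: "vs1.subspace S"
    and closed: "\<And>x. (\<And>e. 0 < e \<Longrightarrow> \<exists>y\<in>S. dist y x < e) \<Longrightarrow> x \<in> S"
  shows "S = UNIV"
proof -
  have "closure S \<subseteq> S"
    using closed by (auto simp: closure_approachable)
  moreover have "closure (vs1.span E) \<subseteq> closure S"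
    by (intro closure_mono vs1.span_minimal E sub)
  ultimately show ?thesis using dense by blast
qed

section \<open>Steerable and vanishable vectors\<close>

text \<open>The vector \<open>v\<close> may depend on \<open>A\<close> and \<open>e\<close>; only
  the target \<open>x\<close> is fixed. Quantifying over every \<open>A\<close> of positive upper
  density allows the set of times to be refined repeatedly.\<close>

definition steerable :: "'a set" where
  "steerable = {x. \<forall>A e. upper_density A > 0 \<longrightarrow> 0 < e \<longrightarrow>
     (\<exists>v B. B \<subseteq> A \<and> upper_density B > 0 \<and> (\<forall>k\<in>B. dist ((T ^^ k) v) x < e))}"

definition rarely_away :: "'a \<Rightarrow> real \<Rightarrow> real \<Rightarrow> bool" where
  "rarely_away u e \<eta> \<longleftrightarrow>
     (\<forall>\<^sub>F n in sequentially. real (card {k\<in>{1..n}. dist ((T ^^ k) u) 0 \<ge> e}) \<le> \<eta> * real n)"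

text \<open>One \<open>e\<close> can serve both closeness conditions, since decreasing it
  strengthens each of them.\<close>

definition vanishable :: "'a set" where
  "vanishable = {x. \<forall>e \<eta>. 0 < e \<longrightarrow> 0 < \<eta> \<longrightarrow> (\<exists>u. dist u x < e \<and> rarely_away u e \<eta>)}"

lemma steerableI:
  assumes "\<And>A e. upper_density A > 0 \<Longrightarrow> 0 < e \<Longrightarrow>
     \<exists>v B. B \<subseteq> A \<and> upper_density B > 0 \<and> (\<forall>k\<in>B. dist ((T ^^ k) v) x < e)"
  shows "x \<in> steerable"
  using assms by (auto simp: steerable_def)

lemma steerableE:
  assumes "x \<in> steerable" "upper_density A > 0" "0 < e"
  obtains v B where "B \<subseteq> A" "upper_density B > 0" "\<forall>k\<in>B. dist ((T ^^ k) v) x < e"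
proof -
  have "\<exists>v B. B \<subseteq> A \<and> upper_density B > 0 \<and> (\<forall>k\<in>B. dist ((T ^^ k) v) x < e)"
    using assms by (simp add: steerable_def)
  with that show thesis by metis
qed

lemma vanishableI:
  assumes "\<And>e \<eta>. 0 < e \<Longrightarrow> 0 < \<eta> \<Longrightarrow> \<exists>u. dist u x < e \<and> rarely_away u e \<eta>"
  shows "x \<in> vanishable"
  using assms by (auto simp: vanishable_def)

lemma vanishableE:
  assumes "x \<in> vanishable" "0 < e" "0 < \<eta>"
  obtains u where "dist u x < e" "rarely_away u e \<eta>"
  using assms unfolding vanishable_def by blast

lemma subspace_steerable: "vs1.subspace steerable"
proof (rule vs1.subspaceI)
  show "0 \<in> steerable"
  proof (rule steerableI)
    fix A e assume "upper_density A > 0" "(0::real) < e"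
    moreover have "(T ^^ k) 0 = 0" for k by (induction k) (simp_all add: zero)
    ultimately show "\<exists>v B. B \<subseteq> A \<and> upper_density B > 0 \<and> (\<forall>k\<in>B. dist ((T ^^ k) v) 0 < e)"
      by (intro exI[of _ 0] exI[of _ A]) simp
  qed
next
  fix x y assume xy: "x \<in> steerable" "y \<in> steerable"
  show "x + y \<in> steerable"
  proof (rule steerableI)
    fix A e assume A: "upper_density A > 0" and e: "(0::real) < e"
    obtain v B where B: "B \<subseteq> A" "upper_density B > 0" "\<forall>k\<in>B. dist ((T ^^ k) v) x < e / 2"
      by (rule steerableE[OF xy(1) A half_gt_zero[OF e]])
    \<comment> \<open>Steering towards \<open>y\<close> inside \<open>B\<close> rather than
      \<open>A\<close> makes both approximations hold along \<open>C\<close>.\<close>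
    obtain w C where C: "C \<subseteq> B" "upper_density C > 0" "\<forall>k\<in>C. dist ((T ^^ k) w) y < e / 2"
      by (rule steerableE[OF xy(2) B(2) half_gt_zero[OF e]])
    have "dist ((T ^^ k) (v + w)) (x + y) < e" if "k \<in> C" for k
    proof -
      have "dist ((T ^^ k) v) x < e / 2" "dist ((T ^^ k) w) y < e / 2"
        using B(3) C(1,3) that by auto
      with dist_add_le[of "(T ^^ k) v" "(T ^^ k) w" x y] show ?thesis
        unfolding funpow_add by linarith
    qed
    with B(1) C(1,2)
    show "\<exists>v B. B \<subseteq> A \<and> upper_density B > 0 \<and> (\<forall>k\<in>B. dist ((T ^^ k) v) (x + y) < e)"
      by blast
  qed
next
  fix c x assume x: "x \<in> steerable"
  show "sc c x \<in> steerable"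
  proof (rule steerableI)
    fix A e assume A: "upper_density A > 0" and e: "(0::real) < e"
    obtain \<delta> where \<delta>: "\<delta> > 0" "\<And>x y. dist x y < \<delta> \<Longrightarrow> dist (sc c x) (sc c y) < e"
      using scale_close[OF e] by blast
    obtain v B where "B \<subseteq> A" "upper_density B > 0" "\<forall>k\<in>B. dist ((T ^^ k) v) x < \<delta>"
      by (rule steerableE[OF x A \<delta>(1)])
    with \<delta>(2) show "\<exists>v B. B \<subseteq> A \<and> upper_density B > 0 \<and> (\<forall>k\<in>B. dist ((T ^^ k) v) (sc c x) < e)"
      by (intro exI[of _ "sc c v"] exI[of _ B]) (simp add: funpow_scale)
  qed
qed

text \<open>The exceptional times of a sum lie in the union of those of its summands, so two bounds
  \<open>\<eta> / 2\<close> add up to \<eta>. For multiples, uniform continuity of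
  \<open>sc c\<close> transfers the exceptional set.\<close>

lemma subspace_vanishable: "vs1.subspace vanishable"
proof (rule vs1.subspaceI)
  show "0 \<in> vanishable"
  proof (rule vanishableI)
    fix e \<eta> :: real assume "0 < e" "0 < \<eta>"
    moreover have "(T ^^ k) 0 = 0" for k by (induction k) (simp_all add: zero)
    ultimately show "\<exists>u. dist u 0 < e \<and> rarely_away u e \<eta>"
      by (intro exI[of _ 0]) (simp add: rarely_away_def)
  qed
next
  fix x y assume xy: "x \<in> vanishable" "y \<in> vanishable"
  show "x + y \<in> vanishable"
  proof (rule vanishableI)
    fix e \<eta> :: real assume e: "0 < e" and \<eta>: "0 < \<eta>"
    obtain u where u: "dist u x < e / 2" "rarely_away u (e / 2) (\<eta> / 2)"
      by (rule vanishableE[OF xy(1) half_gt_zero[OF e] half_gt_zero[OF \<eta>]])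
    obtain w where w: "dist w y < e / 2" "rarely_away w (e / 2) (\<eta> / 2)"
      by (rule vanishableE[OF xy(2) half_gt_zero[OF e] half_gt_zero[OF \<eta>]])
    have "rarely_away (u + w) e \<eta>"
      using u(2) w(2) unfolding rarely_away_def
    proof eventually_elim
      case (elim n)
      let ?K = "\<lambda>u e. {k\<in>{1..n}. dist ((T ^^ k) u) 0 \<ge> e}"
      have "?K (u + w) e \<subseteq> ?K u (e / 2) \<union> ?K w (e / 2)"
      proof
        fix k assume "k \<in> ?K (u + w) e"
        then show "k \<in> ?K u (e / 2) \<union> ?K w (e / 2)"
          using dist_add_le[of "(T ^^ k) u" "(T ^^ k) w" 0 0] by (auto simp: funpow_add)
      qed
      then have "card (?K (u + w) e) \<le> card (?K u (e / 2) \<union> ?K w (e / 2))"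
        by (intro card_mono) auto
      also have "\<dots> \<le> card (?K u (e / 2)) + card (?K w (e / 2))"
        by (rule card_Un_le)
      finally show ?case
        using elim by linarith
    qed
    moreover have "dist (u + w) (x + y) < e"
      using dist_add_le[of u w x y] u(1) w(1) by linarith
    ultimately show "\<exists>u. dist u (x + y) < e \<and> rarely_away u e \<eta>" by blast
  qed
next
  fix c x assume x: "x \<in> vanishable"
  show "sc c x \<in> vanishable"
  proof (rule vanishableI)
    fix e \<eta> :: real assume e: "0 < e" and \<eta>: "0 < \<eta>"
    obtain \<delta> where \<delta>: "\<delta> > 0" "\<And>x y. dist x y < \<delta> \<Longrightarrow> dist (sc c x) (sc c y) < e"
      using scale_close[OF e] by blast
    obtain u where u: "dist u x < \<delta>" "rarely_away u \<delta> \<eta>"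
      by (rule vanishableE[OF x \<delta>(1) \<eta>])
    have "rarely_away (sc c u) e \<eta>"
      using u(2) unfolding rarely_away_def
    proof eventually_elim
      case (elim n)
      have "{k\<in>{1..n}. dist ((T ^^ k) (sc c u)) 0 \<ge> e} \<subseteq> {k\<in>{1..n}. dist ((T ^^ k) u) 0 \<ge> \<delta>}"
        unfolding funpow_scale using \<delta>(2)[of _ 0] by (force simp: not_less[symmetric])
      then have "card {k\<in>{1..n}. dist ((T ^^ k) (sc c u)) 0 \<ge> e}
          \<le> card {k\<in>{1..n}. dist ((T ^^ k) u) 0 \<ge> \<delta>}"
        by (intro card_mono) auto
      with elim show ?case by linarith
    qed
    with u(1) \<delta>(2) show "\<exists>u. dist u (sc c x) < e \<and> rarely_away u e \<eta>" by blast
  qed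
qed

text \<open>Along the orbit of \<open>f\<close> only the phase \<open>z ^ k\<close> moves. Finitely
  many small balls cover the circle, so by pigeonhole the phase stays near one \<open>c\<close>
  along a large part of \<open>A\<close>, and the factor \<open>inverse c\<close> cancels
  it.\<close>

lemma unimodular_eigenvectors_steerable: "unimodular_eigenvectors sc T N \<subseteq> steerable"
proof
  fix f assume "f \<in> unimodular_eigenvectors sc T N"
  then obtain z where z: "cmod z = 1" "T f = sc z f"
    by (auto simp: unimodular_eigenvectors_def)
  show "f \<in> steerable"
  proof (rule steerableI)
    fix A e assume A: "upper_density A > 0" and e: "(0::real) < e"
    obtain \<delta> where \<delta>: "\<delta> > 0" "\<And>c. cmod c < \<delta> \<Longrightarrow> dist (sc c f) 0 < e"
      using small_scalar[OF e] by blast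
    have "compact (sphere (0::complex) 1)" by simp
    then obtain C where C: "finite C" "C \<subseteq> sphere 0 1" "sphere (0::complex) 1 \<subseteq> (\<Union>c\<in>C. ball c \<delta>)"
      by (rule compactE_image[of "sphere 0 1" "sphere 0 1" "\<lambda>c. ball c \<delta>"]) (use \<delta>(1) in force)+
    define B where "B c = {k. cmod (z ^ k - c) < \<delta>}" for c
    have "A \<subseteq> (\<Union>c\<in>C. B c)"
    proof
      fix k
      have "z ^ k \<in> sphere 0 1" using z(1) by (simp add: norm_power)
      then show "k \<in> (\<Union>c\<in>C. B c)"
        using C(3) by (fastforce simp: B_def dist_norm norm_minus_commute)
    qed
    from upper_density_pos_cover[OF C(1) this A] obtain c
      where c: "c \<in> C" "upper_density (A \<inter> B c) > 0" by blast
    have c1: "cmod c = 1" using c(1) C(2) by auto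
    then have "c \<noteq> 0" by auto
    have "dist ((T ^^ k) (sc (inverse c) f)) f < e" if "k \<in> A \<inter> B c" for k
    proof -
      have "cmod (inverse c * z ^ k - 1) = cmod (inverse c * (z ^ k - c))"
        using \<open>c \<noteq> 0\<close> by (simp add: right_diff_distrib)
      also have "\<dots> < \<delta>"
        using that c1 by (simp add: B_def norm_mult norm_inverse)
      finally have "dist (sc (inverse c * z ^ k - 1) f) 0 < e" by (rule \<delta>(2))
      moreover have "sc (inverse c * z ^ k - 1) f = (T ^^ k) (sc (inverse c) f) - f"
        by (simp add: funpow_scale funpow_eigenvector[OF z(2)] vs1.scale_left_diff_distrib)
      ultimately show ?thesis by (simp add: dist_diff_0[of "(T ^^ k) (sc (inverse c) f)" f])
    qed
    with c(2) show "\<exists>v B. B \<subseteq> A \<and> upper_density B > 0 \<and> (\<forall>k\<in>B. dist ((T ^^ k) v) f < e)"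
      by (intro exI[of _ "sc (inverse c) f"] exI[of _ "A \<inter> B c"]) simp
  qed
qed

text \<open>Average \<open>M\<close> eigenvectors near \<open>h\<close> with distinct eigenvalues.
  Uniformly in \<open>k\<close>, the iterate of the average is close to \<open>sc (s k) h\<close>,
  and \<open>s k\<close> is small for most \<open>k\<close> by orthogonality. The \<open>y\<close>
  may be 0, as only distinctness of the eigenvalues enters.\<close>

lemma accumulated_eigenvector_vanishable:
  assumes inf: "\<And>e. 0 < e \<Longrightarrow> infinite {c. cmod c = 1 \<and> (\<exists>y. T y = sc c y \<and> dist y h < e)}"
  shows "h \<in> vanishable"
proof (rule vanishableI)
  fix e \<eta> :: real assume e: "0 < e" and \<eta>: "0 < \<eta>"
  obtain \<delta> where \<delta>: "\<delta> > 0" "\<And>c. cmod c < \<delta> \<Longrightarrow> dist (sc c h) 0 < e / 2"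
    using small_scalar[OF half_gt_zero[OF e]] by blast
  \<comment> \<open>This size of \<open>M\<close> is exactly the hypothesis of the Chebyshev
    bound.\<close>
  obtain M :: nat where M: "1 / (\<delta>\<^sup>2 * \<eta>) < real M"
    using reals_Archimedean2 by blast
  moreover have "0 < 1 / (\<delta>\<^sup>2 * \<eta>)"
    using \<delta>(1) \<eta> by simp
  ultimately have M0: "M > 0"
    using of_nat_0_less_iff[where 'a = real] by linarith
  have large: "real M * \<delta>\<^sup>2 * \<eta> > 1"
    using M \<delta>(1) \<eta> by (simp add: field_simps)
  \<comment> \<open>The \<open>M\<close> errors add up to less than \<open>e / 2\<close>. The
    coefficients \<open>c ^ k / M\<close> have modulus at most 1, so the balanced bound gives a
    \<rho> independent of \<open>k\<close>.\<close>
  have "0 < e / (2 * real M)" using e M0 by simp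
  from small_balanced[OF this] obtain \<rho>
    where \<rho>: "\<rho> > 0" "\<And>c x. cmod c \<le> 1 \<Longrightarrow> dist x 0 < \<rho> \<Longrightarrow> dist (sc c x) 0 < e / (2 * real M)"
    by blast
  obtain L where L: "finite L" "card L = M"
    "L \<subseteq> {c. cmod c = 1 \<and> (\<exists>y. T y = sc c y \<and> dist y h < \<rho>)}"
    using infinite_arbitrarily_large[OF inf[OF \<rho>(1)]] by blast
  then have "\<forall>c\<in>L. \<exists>y. T y = sc c y \<and> dist y h < \<rho>" by blast
  then obtain y where y: "\<And>c. c \<in> L \<Longrightarrow> T (y c) = sc c (y c)" "\<And>c. c \<in> L \<Longrightarrow> dist (y c) h < \<rho>"
    by metis
  have unit: "cmod c = 1" if "c \<in> L" for c using that L(3) by blast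
  define u where "u = (\<Sum>c\<in>L. sc (1 / of_nat M) (y c))"
  define s where "s k = (\<Sum>c\<in>L. c ^ k / of_nat M)" for k
  have orbit: "dist ((T ^^ k) u) (sc (s k) h) < e / 2" for k
  proof -
    have "(T ^^ k) u = (\<Sum>c\<in>L. sc (c ^ k / of_nat M) (y c))"
      unfolding u_def funpow_sum
      by (intro sum.cong refl) (simp add: funpow_scale funpow_eigenvector[OF y(1)])
    then have "(T ^^ k) u - sc (s k) h = (\<Sum>c\<in>L. sc (c ^ k / of_nat M) (y c - h))"
      by (simp add: s_def vs1.scale_sum_left vs1.scale_right_diff_distrib sum_subtractf)
    then have "dist ((T ^^ k) u) (sc (s k) h) \<le> (\<Sum>c\<in>L. dist (sc (c ^ k / of_nat M) (y c - h)) 0)"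
      by (metis dist_diff_0 dist_sum_0_le)
    also have "\<dots> < (\<Sum>c\<in>L. e / (2 * real M))"
    proof (rule sum_strict_mono)
      show "L \<noteq> {}" using L(2) M0 by auto
      show "dist (sc (c ^ k / of_nat M) (y c - h)) 0 < e / (2 * real M)" if "c \<in> L" for c
      proof (rule \<rho>(2))
        show "cmod (c ^ k / of_nat M) \<le> 1"
          using M0 unit[OF that] by (simp add: norm_divide norm_power)
        show "dist (y c - h) 0 < \<rho>"
          using y(2)[OF that] by (simp add: dist_diff_0[of "y c" h])
      qed
    qed (rule L(1))
    also have "\<dots> = e / 2" using L(2) M0 by simp
    finally show ?thesis .
  qed
  \<comment> \<open>At time 0 the orbit estimate compares \<open>u\<close> with \<open>h\<close>
    itself.\<close>
  have "s 0 = 1" using L(2) M0 by (simp add: s_def)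
  then have "dist u h < e" using orbit[of 0] e by simp
  moreover have "\<forall>\<^sub>F n in sequentially.
      real (card {k\<in>{1..n}. cmod (\<Sum>z\<in>L. z ^ k / of_nat M) \<ge> \<delta>}) \<le> \<eta> * real n"
    by (rule power_average_rarely_large[OF L(1) unit \<delta>(1) \<eta>, unfolded L(2)]) (use large in auto)
  then have "rarely_away u e \<eta>"
    unfolding rarely_away_def
  proof (rule eventually_mono)
    fix n assume "real (card {k\<in>{1..n}. cmod (\<Sum>z\<in>L. z ^ k / of_nat M) \<ge> \<delta>}) \<le> \<eta> * real n"
    moreover have "card {k\<in>{1..n}. dist ((T ^^ k) u) 0 \<ge> e}
        \<le> card {k\<in>{1..n}. cmod (\<Sum>z\<in>L. z ^ k / of_nat M) \<ge> \<delta>}"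
    proof (rule card_mono)
      show "{k\<in>{1..n}. dist ((T ^^ k) u) 0 \<ge> e} \<subseteq> {k\<in>{1..n}. cmod (\<Sum>z\<in>L. z ^ k / of_nat M) \<ge> \<delta>}"
      proof safe
        fix k assume "e \<le> dist ((T ^^ k) u) 0"
        then have "\<not> dist (sc (s k) h) 0 < e / 2"
          using orbit[of k] dist_triangle[of "(T ^^ k) u" 0 "sc (s k) h"] by linarith
        then show "\<delta> \<le> cmod (\<Sum>z\<in>L. z ^ k / of_nat M)"
          using \<delta>(2)[of "s k"] unfolding s_def by linarith
      qed
    qed simp
    ultimately show "real (card {k\<in>{1..n}. dist ((T ^^ k) u) 0 \<ge> e}) \<le> \<eta> * real n"
      by linarith
  qed
  ultimately show "\<exists>u. dist u h < e \<and> rarely_away u e \<eta>" by blast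
qed

lemma rarely_away_mono:
  assumes "rarely_away u e \<eta>" "e \<le> e'"
  shows "rarely_away u e' \<eta>"
  using assms(1) unfolding rarely_away_def
proof eventually_elim
  case (elim n)
  have "card {k\<in>{1..n}. dist ((T ^^ k) u) 0 \<ge> e'} \<le> card {k\<in>{1..n}. dist ((T ^^ k) u) 0 \<ge> e}"
    using assms(2) by (intro card_mono) auto
  with elim show ?case by linarith
qed

section \<open>Consequences of perfect spanning\<close>

text \<open>Perfect spanning is applied with no eigenvalue excluded; closedness under limits is the
  triangle inequality in the target.\<close>

lemma steerable_eq_UNIV:
  assumes "perfectly_spanning_T_eigenvectors sc T"
  shows "steerable = UNIV"
proof (rule closed_subspace_UNIV[OF _ unimodular_eigenvectors_steerable subspace_steerable])
  show "closure (vs1.span (unimodular_eigenvectors sc T {})) = UNIV"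
    using assms unfolding perfectly_spanning_T_eigenvectors_def by blast
next
  fix x assume x: "\<And>e. 0 < e \<Longrightarrow> \<exists>y\<in>steerable. dist y x < e"
  show "x \<in> steerable"
  proof (rule steerableI)
    fix A e assume A: "upper_density A > 0" and e: "(0::real) < e"
    obtain y where y: "y \<in> steerable" "dist y x < e / 2"
      using x[OF half_gt_zero[OF e]] by blast
    obtain v B where B: "B \<subseteq> A" "upper_density B > 0" "\<forall>k\<in>B. dist ((T ^^ k) v) y < e / 2"
      by (rule steerableE[OF y(1) A half_gt_zero[OF e]])
    have "dist ((T ^^ k) v) x < e" if "k \<in> B" for k
      using dist_triangle[of "(T ^^ k) v" x y] B(3)[rule_format, OF that] y(2) by linarith
    with B(1,2) show "\<exists>v B. B \<subseteq> A \<and> upper_density B > 0 \<and> (\<forall>k\<in>B. dist ((T ^^ k) v) x < e)"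
      by blast
  qed
qed

lemma vanishable_eq_UNIV:
  assumes sep: "separable_space (euclidean :: 'a topology)"
    and ps: "perfectly_spanning_T_eigenvectors sc T"
  shows "vanishable = UNIV"
proof -
  obtain D :: "'a set" where D: "countable D" "closure D = UNIV"
    using sep by (auto simp: separable_space_def)
  \<comment> \<open>Discarding the eigenvalues that occur only countably often in some ball of a countable
    base leaves eigenvectors near which uncountably many eigenvalues occur.\<close>
  define P where "P d n = {c. cmod c = 1 \<and> (\<exists>y. T y = sc c y \<and> dist y d < inverse (real (Suc n)))}" for d n
  define N where "N = (\<Union>(d, n) \<in> {(d, n). d \<in> D \<and> countable (P d n)}. P d n)"
  have "{(d, n :: nat). d \<in> D \<and> countable (P d n)} \<subseteq> D \<times> UNIV" by auto
  then have "countable {(d, n). d \<in> D \<and> countable (P d n)}"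
    by (rule countable_subset) (use D(1) in auto)
  then have "countable N"
    unfolding N_def by (rule countable_UN) auto
  moreover have "N \<subseteq> {z. cmod z = 1}"
    by (auto simp: N_def P_def)
  ultimately have dense: "closure (vs1.span (unimodular_eigenvectors sc T N)) = UNIV"
    using ps unfolding perfectly_spanning_T_eigenvectors_def by blast
  have eigen: "unimodular_eigenvectors sc T N \<subseteq> vanishable"
  proof
    fix h assume "h \<in> unimodular_eigenvectors sc T N"
    then obtain c where c: "cmod c = 1" "c \<notin> N" "T h = sc c h"
      by (auto simp: unimodular_eigenvectors_def)
    show "h \<in> vanishable"
    proof (rule accumulated_eigenvector_vanishable)
      fix e :: real assume "0 < e"
      \<comment> \<open>Half of \<open>e\<close>, because \<open>h\<close> and the neighbouring
        eigenvectors are both compared with the centre \<open>d\<close>.\<close>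
      then obtain n where n: "inverse (real (Suc n)) < e / 2"
        using reals_Archimedean[of "e / 2"] by auto
      have "h \<in> closure D" "0 < inverse (real (Suc n))" using D(2) by simp_all
      then obtain d where d: "d \<in> D" "dist d h < inverse (real (Suc n))"
        unfolding closure_approachable by blast
      have "c \<in> P d n"
        using c(1,3) d(2) by (auto simp: P_def dist_commute)
      \<comment> \<open>A countable \<open>P d n\<close> would be contained in \<open>N\<close>,
        contradicting \<open>c \<notin> N\<close>.\<close>
      then have "infinite (P d n)"
        using c(2) d(1) countable_finite unfolding N_def by blast
      moreover have "P d n \<subseteq> {c. cmod c = 1 \<and> (\<exists>y. T y = sc c y \<and> dist y h < e)}"
      proof -
        have "dist y h < e" if "dist y d < inverse (real (Suc n))" for y
          using that d(2) n dist_triangle[of y h d] by linarith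
        then show ?thesis by (auto simp: P_def)
      qed
      ultimately show "infinite {c. cmod c = 1 \<and> (\<exists>y. T y = sc c y \<and> dist y h < e)}"
        by (rule infinite_super[rotated])
    qed
  qed
  show ?thesis
  proof (rule closed_subspace_UNIV[OF dense eigen subspace_vanishable])
    fix x assume x: "\<And>e. 0 < e \<Longrightarrow> \<exists>y\<in>vanishable. dist y x < e"
    show "x \<in> vanishable"
    proof (rule vanishableI)
      fix e \<eta> :: real assume e: "0 < e" and \<eta>: "0 < \<eta>"
      obtain y where y: "y \<in> vanishable" "dist y x < e / 2"
        using x[OF half_gt_zero[OF e]] by blast
      obtain u where u: "dist u y < e / 2" "rarely_away u (e / 2) \<eta>"
        by (rule vanishableE[OF y(1) half_gt_zero[OF e] \<eta>])
      have "dist u x < e"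
        using dist_triangle[of u x y] u(1) y(2) by linarith
      moreover have "rarely_away u e \<eta>"
        using rarely_away_mono[OF u(2)] e by simp
      ultimately show "\<exists>u. dist u x < e \<and> rarely_away u e \<eta>" by blast
    qed
  qed
qed

section \<open>Baire category argument\<close>

text \<open>The points with more than \<open>\<beta> * n\<close> visits to \<open>V\<close> at times
  in \<open>A\<close> up to some \<open>n \<ge> N\<close>. Naming a finite set \<open>F\<close> of
  visiting times makes openness immediate: finite intersections of open preimages, then
  unions.\<close>

definition frequent_visitors :: "'a set \<Rightarrow> nat set \<Rightarrow> real \<Rightarrow> nat \<Rightarrow> 'a set" where
  "frequent_visitors V A \<beta> N = (\<Union>n\<in>{N..}. \<Union>F\<in>{F. F \<subseteq> A \<inter> {1..n} \<and> real (card F) > \<beta> * real n}.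
     \<Inter>k\<in>F. (T ^^ k) -` V)"

lemma open_frequent_visitors:
  assumes "open V"
  shows "open (frequent_visitors V A \<beta> N)"
  unfolding frequent_visitors_def
proof (intro open_UN ballI)
  fix n F assume "F \<in> {F. F \<subseteq> A \<inter> {1..n} \<and> real (card F) > \<beta> * real n}"
  then have "finite F" by (auto intro: finite_subset)
  then show "open (\<Inter>k\<in>F. (T ^^ k) -` V)"
    using assms continuous_funpow by (intro open_INT ballI open_vimage)
qed

text \<open>The bound comes from \<open>v\<close> and \<open>B\<close>, which are fixed before
  \<open>N\<close>, \<open>y\<close> and \<open>e\<close>. Adding a vanishable correction
  \<open>u\<close> moves \<open>v\<close> close to any \<open>y\<close> and spoils only a small part
  of the visits along \<open>B\<close>.\<close>

lemma dense_frequent_visitors: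
  assumes steer: "steerable = UNIV" and vanish: "vanishable = UNIV"
    and V: "open V" "V \<noteq> {}" and A: "upper_density A > 0"
  shows "\<exists>\<beta>>0. \<forall>N. closure (frequent_visitors V A \<beta> N) = UNIV"
proof -
  obtain x\<^sub>0 r where r: "r > 0" "ball x\<^sub>0 r \<subseteq> V"
    using V by (metis all_not_in_conv open_contains_ball)
  have "x\<^sub>0 \<in> steerable" using steer by simp
  then obtain v B where B: "B \<subseteq> A" "upper_density B > 0" "\<forall>k\<in>B. dist ((T ^^ k) v) x\<^sub>0 < r / 2"
    by (rule steerableE[OF _ A half_gt_zero[OF r(1)]])
  obtain \<beta> where \<beta>: "\<beta> > 0" "\<exists>\<^sub>F n in sequentially. real (card (B \<inter> {1..n})) > \<beta> * real n"
    using B(2) unfolding upper_density_pos_iff by blast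
  have "\<exists>x \<in> frequent_visitors V A (\<beta> / 2) N. dist x y < e" if e: "0 < e" for N y e
  proof -
    have e': "0 < min e (r / 2)" using e r(1) by simp
    have "y - v \<in> vanishable" using vanish by simp
    \<comment> \<open>Aiming at \<open>y - v\<close> puts \<open>u + v\<close> near
      \<open>y\<close>; exceptional density \<open>\<beta> / 2\<close> leaves half of the bound for
      \<open>B\<close>.\<close>
    then obtain u where u: "dist u (y - v) < min e (r / 2)" "rarely_away u (min e (r / 2)) (\<beta> / 2)"
      by (rule vanishableE[OF _ e' half_gt_zero[OF \<beta>(1)]])
    from u(2) have "rarely_away u (r / 2) (\<beta> / 2)"
      by (rule rarely_away_mono) simp
    then have "\<forall>\<^sub>F n in sequentially. n \<ge> N \<and>
        real (card {k\<in>{1..n}. dist ((T ^^ k) u) 0 \<ge> r / 2}) \<le> \<beta> / 2 * real n"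
      unfolding rarely_away_def by (intro eventually_conj eventually_ge_at_top)
    \<comment> \<open>\<open>B\<close> is dense enough only for infinitely many \<open>n\<close>,
      while the exceptional set is sparse for all large \<open>n\<close>, so a common
      \<open>n \<ge> N\<close> exists.\<close>
    from frequently_ex[OF frequently_eventually_frequently[OF \<beta>(2) this]] obtain n
      where n: "real (card (B \<inter> {1..n})) > \<beta> * real n" "n \<ge> N"
        "real (card {k\<in>{1..n}. dist ((T ^^ k) u) 0 \<ge> r / 2}) \<le> \<beta> / 2 * real n"
      by blast
    let ?K = "{k\<in>{1..n}. dist ((T ^^ k) u) 0 \<ge> r / 2}"
    define F where "F = B \<inter> {1..n} - ?K"
    have "card (B \<inter> {1..n}) - card ?K \<le> card F"
      unfolding F_def by (rule diff_card_le_card_Diff) simp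
    then have "real (card F) > \<beta> / 2 * real n"
      using n(1,3) by linarith
    moreover have "F \<subseteq> A \<inter> {1..n}" using B(1) by (auto simp: F_def)
    moreover have "(T ^^ k) (u + v) \<in> V" if "k \<in> F" for k
    proof -
      have "dist ((T ^^ k) u) 0 < r / 2" "dist ((T ^^ k) v) x\<^sub>0 < r / 2"
        using that B(3) by (auto simp: F_def)
      then have "dist ((T ^^ k) (u + v)) x\<^sub>0 < r"
        using dist_add_le[of "(T ^^ k) u" "(T ^^ k) v" 0 x\<^sub>0] by (simp add: funpow_add)
      with r(2) show ?thesis by (auto simp: dist_commute)
    qed
    ultimately have "u + v \<in> frequent_visitors V A (\<beta> / 2) N"
      using n(2) unfolding frequent_visitors_def by blast
    moreover have "dist (u + v) y < e"
      using u(1) dist_translate[of u v "y - v"] by simp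
    ultimately show ?thesis by blast
  qed
  then have "closure (frequent_visitors V A (\<beta> / 2) N) = UNIV" for N
    by (auto simp: closure_approachable)
  with \<beta>(1) half_gt_zero show ?thesis by blast
qed

lemma upper_density_return_set_pos:
  assumes "\<beta> > 0" and x: "\<And>N. x \<in> frequent_visitors V A \<beta> N"
  shows "upper_density (return_set T x V \<inter> A) > 0"
proof -
  have "\<exists>n\<ge>N. real (card (return_set T x V \<inter> A \<inter> {1..n})) > \<beta> * real n" for N
  proof -
    obtain n F where n: "n \<ge> N" and F: "F \<subseteq> A \<inter> {1..n}" "real (card F) > \<beta> * real n"
        "\<forall>k\<in>F. (T ^^ k) x \<in> V"
      using x[of N] unfolding frequent_visitors_def by auto
    have "card F \<le> card (return_set T x V \<inter> A \<inter> {1..n})"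
      using F(1,3) by (intro card_mono) (auto simp: return_set_def)
    with F(2) n show ?thesis by (intro exI[of _ n]) linarith
  qed
  with assms(1) show ?thesis
    unfolding upper_density_pos_iff frequently_sequentially by blast
qed

lemma hereditarily_U_frequently_hypercyclic:
  assumes steer: "steerable = UNIV" and vanish: "vanishable = UNIV"
  shows "hereditarily_U_frequently_hypercyclic T"
  unfolding hereditarily_U_frequently_hypercyclic_def
proof (intro allI impI)
  fix I :: "nat set" and V :: "nat \<Rightarrow> 'a set" and A :: "nat \<Rightarrow> nat set"
  assume VA: "\<forall>i\<in>I. open (V i) \<and> V i \<noteq> {} \<and> upper_density (A i) > 0"
  have "\<forall>i\<in>I. \<exists>\<beta>>0. \<forall>N. closure (frequent_visitors (V i) (A i) \<beta> N) = UNIV"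
    using VA dense_frequent_visitors[OF steer vanish] by blast
  then obtain \<beta> where \<beta>: "\<And>i. i \<in> I \<Longrightarrow> \<beta> i > 0"
      "\<And>i N. i \<in> I \<Longrightarrow> closure (frequent_visitors (V i) (A i) (\<beta> i) N) = UNIV"
    by metis
  \<comment> \<open>Each \<open>\<beta> i\<close> is independent of \<open>N\<close>, so a point of
    the intersection visits \<open>V i\<close> with one fixed bound at arbitrarily large
    \<open>n\<close>.\<close>
  define \<G> where "\<G> = (\<lambda>(i, N). frequent_visitors (V i) (A i) (\<beta> i) N) ` (I \<times> UNIV)"
  have "Met_TC.mtopology closure_of \<Inter>\<G> = UNIV"
  proof (rule Met_TC.metric_Baire_category)
    show "Met_TC.mcomplete TYPE('a)" using complete_space by simp
    show "countable \<G>" unfolding \<G>_def by (intro countable_image) simp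
    show "openin Met_TC.mtopology G \<and> Met_TC.mtopology closure_of G = UNIV" if "G \<in> \<G>" for G
      using that VA \<beta>(2) by (auto simp: \<G>_def open_frequent_visitors)
  qed
  \<comment> \<open>The closure of the empty set is empty, whereas this closure is the whole
    space.\<close>
  then have "\<Inter>\<G> \<noteq> {}" by force
  then obtain x where x: "x \<in> \<Inter>\<G>" by blast
  have "upper_density (return_set T x (V i) \<inter> A i) > 0" if "i \<in> I" for i
    using upper_density_return_set_pos[OF \<beta>(1)[OF that]] x that by (auto simp: \<G>_def)
  then show "\<exists>x. \<forall>i\<in>I. upper_density (return_set T x (V i) \<inter> A i) > 0" by blast
qed

end

theorem theorem3p20:
  fixes sc :: "complex \<Rightarrow> 'a::{ab_group_add,metric_space} \<Rightarrow> 'a"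
    and T :: "'a \<Rightarrow> 'a"
  assumes "frechet_space sc"
    and "separable_space (euclidean :: 'a topology)"
    and "bounded_operator sc T"
    and "perfectly_spanning_T_eigenvectors sc T"
  shows "hereditarily_U_frequently_hypercyclic T"
proof -
  interpret Vector_Spaces.linear sc sc T
    using assms(3) by (simp add: bounded_operator_def)
  interpret frechet_operator sc T
    using assms(1,3) by unfold_locales (auto simp: frechet_space_def bounded_operator_def)
  show ?thesis
    using assms(2,4)
    by (intro hereditarily_U_frequently_hypercyclic steerable_eq_UNIV vanishable_eq_UNIV)
qed

end
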